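(* Let $K,N\ge1$, $NK<m$, $\mathbf{\Phi}\in\mathbb{R}^{m\times n}$, let $\mathbf{x}\in\mathbb{R}^n$ be $K$-sparse, and let $\mathbf{y}'=\mathbf{\Phi}\mathbf{x}+\mathbf{e}$ with noise $\mathbf{e}\in\mathbb{R}^m$, $\mathbf{e}\ne0$. Suppose the generalized orthogonal matching pursuit algorithm (gOMP), selecting $N$ atoms per iteration, is applied to input $(\mathbf{y}',\mathbf{\Phi})$ with stopping criterion $k=K$, and let $\mathbf{x}_{\Lambda^K}$ be its estimate after $K$ iterations. If $\delta_{NK+K}<1$ and $$\delta_{NK+1}<\frac{\sqrt{N}}{\sqrt{K}+\sqrt{N}},$$ then $\|\mathbf{x}-\mathbf{x}_{\Lambda^K}\|_2<C_{K_2}\|\mathbf{e}\|_2$, where $$C_{K_2}=\frac{\sqrt{N}(1+\delta_K)+\sqrt{K(1+\delta_N)(1+\delta_K)}}{\left(\sqrt{N}-(\sqrt{K}+\sqrt{N})\delta_{NK+1}\right)\sqrt{1-\delta_{NK+K}}}+\frac{2}{\sqrt{1-\delta_{NK+K}}}.$$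
   Context: A vector is $K$-sparse if it has at most $K$ nonzero entries. For an index set $I\subseteq\{1,\dots,n\}$, $\mathbf{\Phi}_I$ is the submatrix of $\mathbf{\Phi}$ with columns indexed by $I$; $\phi_j$ is the $j$-th column of $\mathbf{\Phi}$. RIP: $\mathbf{\Phi}\in\mathbb{R}^{m\times n}$ satisfies the restricted isometry property of order $L$ if there is $\delta\in(0,1)$ such that for all $I\subseteq\{1,\dots,n\}$ with $|I|\le L$ and all $\mathbf{q}\in\mathbb{R}^{I}$, $(1-\delta)\|\mathbf{q}\|_2^2\le\|\mathbf{\Phi}_I\mathbf{q}\|_2^2\le(1+\delta)\|\mathbf{q}\|_2^2$. The RIP constant $\delta_L$ is the smallest $\delta$ for which these inequalities hold. gOMP algorithm with stopping criterion $k=K$ (input a measurement $\mathbf{v}\in\mathbb{R}^m$ and $\mathbf{\Phi}\in\mathbb{R}^{m\times n}$): set $\mathbf{r}^0=\mathbf{v}$, $\Lambda^0=\emptyset$. For $k=1,\dots,K$: let $h^k$ be a set of $N$ indices $j\in\{1,\dots,n\}$ for which $|\langle \mathbf{r}^{k-1},\phi_j\rangle|$ is largest; put $\Lambda^k=\Lambda^{k-1}\cup h^k$; let $\mathbf{x}_{\Lambda^k}\in\mathbb{R}^n$ be the minimizer of $\|\mathbf{v}-\mathbf{\Phi}\mathbf{z}\|_2$ over $\mathbf{z}\in\mathbb{R}^n$ supported in $\Lambda^k$; put $\mathbf{r}^k=\mathbf{v}-\mathbf{\Phi}\mathbf{x}_{\Lambda^k}$. It is assumed that the matrices $\mathbf{\Phi}_{\Lambda^k}$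 have full column rank. *)

theory Defs
  imports "HOL-Analysis.Analysis"
begin

definition supp :: "real ^ 'n \<Rightarrow> 'n set" where
  "supp z = {j. z $ j \<noteq> 0}"

definition ksparse :: "nat \<Rightarrow> real ^ 'n \<Rightarrow> bool" where
  "ksparse K z \<longleftrightarrow> card (supp z) \<le> K"

text \<open>
  A vector indexed by a column set \<open>I\<close> is represented by its extension by zero, i.e. by a vector
  \<open>q\<close> with \<open>supp q \<subseteq> I\<close>. The extension has the same Euclidean norm, and the product of the
  column submatrix for \<open>I\<close> with the restricted vector is \<open>\<Phi> *v q\<close>.
\<close>

definition rip_bound :: "real ^ 'n ^ 'm \<Rightarrow> nat \<Rightarrow> real \<Rightarrow> bool" where
  "rip_bound \<Phi> L \<delta> \<longleftrightarrow>
     (\<forall>I. card I \<le> L \<longrightarrow> (\<forall>q. supp q \<subseteq> I \<longrightarrow>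
        (1 - \<delta>) * (norm q)\<^sup>2 \<le> (norm (\<Phi> *v q))\<^sup>2 \<and>
        (norm (\<Phi> *v q))\<^sup>2 \<le> (1 + \<delta>) * (norm q)\<^sup>2))"

text \<open>
  The minimum exists for every matrix when \<open>L \<ge> 1\<close> (see \<open>rip_const_attained\<close> below), and it is
  then nonnegative; its value may be \<open>\<ge> 1\<close>. For \<open>L = 0\<close> the value is unspecified.
\<close>

definition rip_const :: "real ^ 'n ^ 'm \<Rightarrow> nat \<Rightarrow> real" where
  "rip_const \<Phi> L = (LEAST \<delta>. rip_bound \<Phi> L \<delta>)"

lemma rip_bound_nonneg:
  fixes \<Phi> :: "real ^ 'n ^ 'm"
  assumes "L \<ge> 1" "rip_bound \<Phi> L \<delta>"
  shows "\<delta> \<ge> 0"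
proof -
  fix j :: 'n
  have s: "supp (axis j (1::real)) \<subseteq> {j}" by (auto simp: supp_def axis_def split: if_splits)
  have c: "card {j} \<le> L" using assms(1) by simp
  have n: "norm (axis j (1::real)) = 1" by simp
  from assms(2) s c have
    "(1 - \<delta>) * (norm (axis j (1::real)))\<^sup>2 \<le> (norm (\<Phi> *v axis j 1))\<^sup>2 \<and>
     (norm (\<Phi> *v axis j 1))\<^sup>2 \<le> (1 + \<delta>) * (norm (axis j (1::real)))\<^sup>2"
    unfolding rip_bound_def by blast
  then show ?thesis unfolding n by simp
qed

lemma rip_bound_exists:
  fixes \<Phi> :: "real ^ 'n ^ 'm"
  shows "\<exists>\<delta>. rip_bound \<Phi> L \<delta>"
proof -
  define B where "B = onorm ((*v) \<Phi>)"
  have b: "norm (\<Phi> *v q) \<le> B * norm q" for q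
    unfolding B_def by (rule onorm) (simp add: matrix_vector_mul_bounded_linear)
  have "(norm (\<Phi> *v q))\<^sup>2 \<le> (1 + (1 + B\<^sup>2)) * (norm q)\<^sup>2" for q
  proof -
    have "(norm (\<Phi> *v q))\<^sup>2 \<le> (B * norm q)\<^sup>2" using b by (intro power_mono) auto
    also have "\<dots> = B\<^sup>2 * (norm q)\<^sup>2" by (rule power_mult_distrib)
    also have "\<dots> \<le> (1 + (1 + B\<^sup>2)) * (norm q)\<^sup>2" by (intro mult_right_mono) auto
    finally show ?thesis .
  qed
  moreover have "(1 - (1 + B\<^sup>2)) * (norm q)\<^sup>2 \<le> (norm (\<Phi> *v q))\<^sup>2" for q
  proof -
    have "(1 - (1 + B\<^sup>2)) * (norm q)\<^sup>2 \<le> 0" by (intro mult_nonpos_nonneg) auto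
    also have "0 \<le> (norm (\<Phi> *v q))\<^sup>2" by simp
    finally show ?thesis .
  qed
  ultimately show ?thesis unfolding rip_bound_def by blast
qed

lemma rip_const_attained:
  fixes \<Phi> :: "real ^ 'n ^ 'm"
  assumes "L \<ge> 1"
  shows "rip_bound \<Phi> L (rip_const \<Phi> L)"
    and "rip_bound \<Phi> L \<delta> \<Longrightarrow> rip_const \<Phi> L \<le> \<delta>"
proof -
  define S where "S = {\<delta>. rip_bound \<Phi> L \<delta>}"
  have "S = (\<Inter>I\<in>{I. card I \<le> L}. \<Inter>q\<in>{q. supp q \<subseteq> I}.
      {\<delta>. (1 - \<delta>) * (norm q)\<^sup>2 \<le> (norm (\<Phi> *v q))\<^sup>2} \<inter>
      {\<delta>. (norm (\<Phi> *v q))\<^sup>2 \<le> (1 + \<delta>) * (norm q)\<^sup>2})"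
    unfolding S_def rip_bound_def by auto
  also have "closed \<dots>"
    by (intro closed_INT ballI closed_Int closed_Collect_le continuous_intros)
  finally have cl: "closed S" .
  have ne: "S \<noteq> {}" using rip_bound_exists[of \<Phi> L] by (auto simp: S_def)
  have bd: "bdd_below S"
    using rip_bound_nonneg[OF assms] by (intro bdd_belowI[of _ 0]) (auto simp: S_def)
  have m: "rip_bound \<Phi> L (Inf S)"
    using closed_contains_Inf[OF ne bd cl] by (simp add: S_def)
  have l: "Inf S \<le> d" if "rip_bound \<Phi> L d" for d
    using that bd by (intro cInf_lower) (auto simp: S_def)
  have eq: "rip_const \<Phi> L = Inf S"
    unfolding rip_const_def by (rule Least_equality) (use m l in auto)
  show "rip_bound \<Phi> L (rip_const \<Phi> L)" using m eq by simp
  show "rip_bound \<Phi> L \<delta> \<Longrightarrow> rip_const \<Phi> L \<le> \<delta>" using l eq by simp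
qed

text \<open>Full column rank of the column submatrix: its column rank is the number of its columns.\<close>

definition full_column_rank_on :: "real ^ 'n ^ 'm \<Rightarrow> 'n set \<Rightarrow> bool" where
  "full_column_rank_on \<Phi> I \<longleftrightarrow> dim ((\<lambda>j. column j \<Phi>) ` I) = card I"

definition top_correlated ::
    "real ^ 'n ^ 'm \<Rightarrow> real ^ 'm \<Rightarrow> nat \<Rightarrow> 'n set \<Rightarrow> bool" where
  "top_correlated \<Phi> r N h \<longleftrightarrow> card h = N \<and>
     (\<forall>i\<in>h. \<forall>j. j \<notin> h \<longrightarrow> \<bar>r \<bullet> column j \<Phi>\<bar> \<le> \<bar>r \<bullet> column i \<Phi>\<bar>)"

text \<open>
  The index selection may involve ties, so the algorithm is rendered as the relation
  ``these sequences are a possible execution on input \<open>(v, \<Phi>)\<close>''. Entries with index \<open>> K\<close>, as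
  well as \<open>h 0\<close> and \<open>xh 0\<close>, are irrelevant. Here \<open>\<Lambda> k\<close> is the support estimate, \<open>xh k\<close> the
  least-squares estimate and \<open>r k\<close> the residual after \<open>k\<close> iterations.
\<close>

definition gomp_run ::
    "real ^ 'n ^ 'm \<Rightarrow> real ^ 'm \<Rightarrow> nat \<Rightarrow> nat \<Rightarrow>
     (nat \<Rightarrow> 'n set) \<Rightarrow> (nat \<Rightarrow> 'n set) \<Rightarrow> (nat \<Rightarrow> real ^ 'n) \<Rightarrow> (nat \<Rightarrow> real ^ 'm) \<Rightarrow> bool" where
  "gomp_run \<Phi> v N K h \<Lambda> xh r \<longleftrightarrow>
     r 0 = v \<and> \<Lambda> 0 = {} \<and>
     (\<forall>k\<in>{1..K}.
        top_correlated \<Phi> (r (k - 1)) N (h k) \<and>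
        \<Lambda> k = \<Lambda> (k - 1) \<union> h k \<and>
        is_arg_min (\<lambda>z. norm (v - \<Phi> *v z)) (\<lambda>z. supp z \<subseteq> \<Lambda> k) (xh k) \<and>
        r k = v - \<Phi> *v xh k)"

definition C_K2 :: "real ^ 'n ^ 'm \<Rightarrow> nat \<Rightarrow> nat \<Rightarrow> real" where
  "C_K2 \<Phi> N K =
     (sqrt (real N) * (1 + rip_const \<Phi> K)
        + sqrt (real K * (1 + rip_const \<Phi> N) * (1 + rip_const \<Phi> K)))
     / ((sqrt (real N) - (sqrt (real K) + sqrt (real N)) * rip_const \<Phi> (N * K + 1))
        * sqrt (1 - rip_const \<Phi> (N * K + K)))
     + 2 / sqrt (1 - rip_const \<Phi> (N * K + K))"

end

theory Submission
  imports Defs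
begin

text \<open>
  If every iteration selects a new index of the support \<open>T\<close> of \<open>x\<close>, then \<open>T\<close> is exhausted after
  \<open>K\<close> iterations and the final residual is at most \<open>\<parallel>e\<parallel>\<close>. Otherwise consider the first failing
  iteration, with support estimate \<open>\<Lambda>\<close> and \<open>S = T - \<Lambda>\<close>. Its residual is \<open>\<Phi> w + e'\<close>, where
  \<open>w\<close> agrees with \<open>x\<close> on \<open>S\<close>, is supported in \<open>T \<union> \<Lambda>\<close>, and both summands are orthogonal to the
  columns in \<open>\<Lambda>\<close>. The correlations of the residual with the columns in \<open>S\<close> are at least of order
  \<open>(1 - \<delta>)\<parallel>w\<parallel>\<close> and those with the selected columns at most of order \<open>\<delta>\<parallel>w\<parallel>\<close>, up to multiples
  of \<open>\<parallel>e\<parallel>\<close>; since the selected ones are the largest, this bounds \<open>w\<close>, hence the residual, by a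
  multiple of \<open>\<parallel>e\<parallel>\<close>. Residual norms do not increase afterwards, and the restricted isometry
  property of order \<open>NK + K\<close> turns the residual bound into an error bound.
\<close>

section \<open>Restriction of vectors to index sets, and correlations as a vector\<close>

definition restrict_vec :: "'n set \<Rightarrow> real ^ 'n \<Rightarrow> real ^ 'n" where
  "restrict_vec I z = (\<chi> j. if j \<in> I then z $ j else 0)"

lemma supp_restrict_vec: "supp (restrict_vec I z) = I \<inter> supp z"
  by (auto simp: supp_def restrict_vec_def)

lemma inner_restrict_vec: "restrict_vec I p \<bullet> q = (\<Sum>j\<in>I. p $ j * q $ j)"
proof -
  have "restrict_vec I p \<bullet> q = (\<Sum>j\<in>UNIV. if j \<in> I then p $ j * q $ j else 0)"
    by (auto simp: inner_vec_def restrict_vec_def intro!: sum.cong)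
  also have "\<dots> = (\<Sum>j\<in>I. p $ j * q $ j)"
    by (simp add: sum.If_cases)
  finally show ?thesis .
qed

lemma inner_restrict_vec_both: "restrict_vec I p \<bullet> restrict_vec I q = restrict_vec I p \<bullet> q"
  unfolding inner_restrict_vec by (intro sum.cong) (auto simp: restrict_vec_def)

lemma norm_restrict_vec_sq: "(norm (restrict_vec I z))\<^sup>2 = restrict_vec I z \<bullet> z"
  by (metis inner_restrict_vec_both power2_norm_eq_inner)

lemma norm_restrict_vec_le: "norm (restrict_vec I z) \<le> norm z"
  by (rule norm_le_componentwise_cart) (auto simp: restrict_vec_def)

text \<open>Turns the correlations of the selection rule into coordinates of one vector, which can
  be restricted to index sets and measured in the Euclidean norm.\<close>

lemma vector_matrix_mult_nth: "(r v* \<Phi>) $ j = r \<bullet> column j \<Phi>"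
  by (simp add: vector_matrix_mult_def inner_vec_def column_def mult.commute)

section \<open>Orthogonality of residuals and projection onto column spans\<close>

lemma orthogonal_range_of_columns:
  fixes \<Phi> :: "real ^ 'n ^ 'm"
  assumes "\<And>j. j \<in> I \<Longrightarrow> r \<bullet> column j \<Phi> = 0" "supp z \<subseteq> I"
  shows "r \<bullet> (\<Phi> *v z) = 0"
proof -
  have "(r v* \<Phi>) $ j = 0 \<or> z $ j = 0" for j
    using assms by (auto simp: supp_def vector_matrix_mult_nth)
  then have "(r v* \<Phi>) \<bullet> z = 0"
    unfolding inner_vec_def by (intro sum.neutral) auto
  then show ?thesis by (simp add: dot_lmul_matrix)
qed

text \<open>The projection coefficient \<open>t\<close> of \<open>a\<close> on \<open>b\<close>
  lowers the squared norm by \<open>t\<^sup>2 * (b \<bullet> b)\<close>; minimality forces this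
  decrease to vanish.\<close>

lemma orthogonal_if_norm_minimal:
  fixes a b :: "'a :: real_inner"
  assumes "\<And>t. norm a \<le> norm (a - t *\<^sub>R b)"
  shows "a \<bullet> b = 0"
proof (cases "b = 0")
  case False
  define t where "t = (a \<bullet> b) / (b \<bullet> b)"
  have "b \<bullet> b > 0" using False by simp
  then have tb: "t * (b \<bullet> b) = a \<bullet> b" by (simp add: t_def)
  have "(norm a)\<^sup>2 \<le> (norm (a - t *\<^sub>R b))\<^sup>2"
    using assms by (intro power_mono) auto
  also have "\<dots> = (norm a)\<^sup>2 - 2 * t * (a \<bullet> b) + t * (t * (b \<bullet> b))"
    unfolding power2_norm_eq_inner by (simp add: inner_diff_left inner_diff_right inner_commute)
  also have "\<dots> = (norm a)\<^sup>2 - t\<^sup>2 * (b \<bullet> b)"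
    using tb by (simp add: algebra_simps power2_eq_square)
  finally have "t\<^sup>2 * (b \<bullet> b) \<le> 0" by simp
  then have "t = 0" using \<open>b \<bullet> b > 0\<close> by (simp add: mult_le_0_iff)
  then show ?thesis using tb by simp
qed simp

lemma least_squares_residual_orthogonal:
  fixes \<Phi> :: "real ^ 'n ^ 'm"
  assumes "is_arg_min (\<lambda>z. norm (v - \<Phi> *v z)) (\<lambda>z. supp z \<subseteq> I) u" "j \<in> I"
  shows "(v - \<Phi> *v u) \<bullet> column j \<Phi> = 0"
proof (rule orthogonal_if_norm_minimal)
  fix t
  have "supp (u + t *\<^sub>R axis j 1) \<subseteq> I"
    using assms by (auto simp: is_arg_min_def supp_def axis_def split: if_splits)
  then have "norm (v - \<Phi> *v u) \<le> norm (v - \<Phi> *v (u + t *\<^sub>R axis j 1))"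
    using assms by (auto simp: is_arg_min_linorder)
  then show "norm (v - \<Phi> *v u) \<le> norm (v - \<Phi> *v u - t *\<^sub>R column j \<Phi>)"
    by (simp add: matrix_vector_right_distrib matrix_vector_mult_scaleR
        matrix_vector_mul_component matrix_vector_mult_basis algebra_simps)
qed

text \<open>Meant for the noise: its projection onto the span of the columns in \<open>I\<close> has
  the form \<open>\<Phi> *v a\<close> and can be counted as signal, which leaves a remainder
  orthogonal to these columns.\<close>

lemma column_span_decomp:
  fixes \<Phi> :: "real ^ 'n ^ 'm"
  obtains a where "supp a \<subseteq> I" "\<And>j. j \<in> I \<Longrightarrow> (v - \<Phi> *v a) \<bullet> column j \<Phi> = 0"
    "norm (v - \<Phi> *v a) \<le> norm v"
proof -
  define V where "V = (\<lambda>z. \<Phi> *v z) ` {z. supp z \<subseteq> I}"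
  have "subspace {z :: real ^ 'n. supp z \<subseteq> I}"
    by (force simp: subspace_def supp_def)
  then have "subspace V"
    unfolding V_def by (intro linear_subspace_image) auto
  then have "span V = V" by simp
  then obtain y z where yz: "y \<in> V" "\<And>w. w \<in> V \<Longrightarrow> orthogonal z w" "v = y + z"
    using orthogonal_subspace_decomp_exists[of V v] by metis
  then obtain a where a: "supp a \<subseteq> I" "y = \<Phi> *v a" by (auto simp: V_def)
  have z: "z = v - \<Phi> *v a" using yz a by simp
  have "column j \<Phi> \<in> V" if "j \<in> I" for j
  proof -
    have "supp (axis j 1 :: real ^ 'n) \<subseteq> I"
      using that by (auto simp: supp_def axis_def split: if_splits)
    then show ?thesis
      unfolding V_def by (metis image_eqI matrix_vector_mult_basis mem_Collect_eq)
  qed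
  moreover have "norm z \<le> norm v"
  proof -
    have "orthogonal y z" using yz by (simp add: orthogonal_commute)
    then have "(norm v)\<^sup>2 = (norm y)\<^sup>2 + (norm z)\<^sup>2"
      unfolding yz(3) by (rule norm_add_Pythagorean)
    then show ?thesis by (simp add: power2_le_imp_le)
  qed
  ultimately show ?thesis
    using that a yz(2) unfolding z orthogonal_def by blast
qed

section \<open>Restricted isometry estimates and comparison of correlations\<close>

lemma rip_lower:
  assumes "rip_bound \<Phi> L \<delta>" "supp q \<subseteq> I" "card I \<le> L"
  shows "(1 - \<delta>) * (norm q)\<^sup>2 \<le> (norm (\<Phi> *v q))\<^sup>2"
  using assms unfolding rip_bound_def by blast

lemma rip_upper_norm:
  assumes "rip_bound \<Phi> L \<delta>" "supp q \<subseteq> I" "card I \<le> L"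
  shows "norm (\<Phi> *v q) \<le> sqrt (1 + \<delta>) * norm q"
proof -
  have "(norm (\<Phi> *v q))\<^sup>2 \<le> (1 + \<delta>) * (norm q)\<^sup>2"
    using assms unfolding rip_bound_def by blast
  then have "sqrt ((norm (\<Phi> *v q))\<^sup>2) \<le> sqrt ((1 + \<delta>) * (norm q)\<^sup>2)"
    by (rule real_sqrt_le_mono)
  then show ?thesis by (simp add: real_sqrt_mult)
qed

text \<open>Polarization, with the upper RIP inequality for \<open>p' + q'\<close> and the lower one
  for \<open>p' - q'\<close>, whose norms agree by disjointness. Rescaling to a common norm first
  yields the product of the norms; unscaled vectors would give the mean of the squared
  norms.\<close>

lemma rip_disjoint_supp_inner_le:
  fixes \<Phi> :: "real ^ 'n ^ 'm"
  assumes rip: "rip_bound \<Phi> L \<delta>" and I: "supp p \<union> supp q \<subseteq> I" "card I \<le> L"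
    and disj: "supp p \<inter> supp q = {}"
  shows "(\<Phi> *v p) \<bullet> (\<Phi> *v q) \<le> \<delta> * norm p * norm q"
proof (cases "p = 0 \<or> q = 0")
  case False
  define \<nu> where "\<nu> = norm p * norm q"
  have \<nu>: "\<nu> > 0" using False by (simp add: \<nu>_def)
  define p' q' where "p' = norm q *\<^sub>R p" and "q' = norm p *\<^sub>R q"
  have n: "norm p' = \<nu>" "norm q' = \<nu>" by (simp_all add: p'_def q'_def \<nu>_def)
  have "p' \<bullet> q' = 0"
    unfolding inner_vec_def
    by (rule sum.neutral) (use disj in \<open>auto simp: p'_def q'_def supp_def\<close>)
  then have pq: "(norm (p' + q'))\<^sup>2 = 2 * \<nu>\<^sup>2" "(norm (p' - q'))\<^sup>2 = 2 * \<nu>\<^sup>2"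
    using dot_norm[of p' q'] dot_norm_neg[of p' q'] n by auto
  have s: "supp (p' + q') \<subseteq> I" "supp (p' - q') \<subseteq> I"
    using I by (force simp: p'_def q'_def supp_def)+
  have "(norm (\<Phi> *v (p' + q')))\<^sup>2 \<le> (1 + \<delta>) * (2 * \<nu>\<^sup>2)"
    "(1 - \<delta>) * (2 * \<nu>\<^sup>2) \<le> (norm (\<Phi> *v (p' - q')))\<^sup>2"
    using rip I s pq unfolding rip_bound_def by metis+
  moreover have "(norm (\<Phi> *v (p' + q')))\<^sup>2 - (norm (\<Phi> *v (p' - q')))\<^sup>2
      = 4 * ((\<Phi> *v p') \<bullet> (\<Phi> *v q'))"
    unfolding power2_norm_eq_inner matrix_vector_right_distrib matrix_vector_mult_diff_distrib
    by (simp add: inner_simps inner_commute)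
  ultimately have "(\<Phi> *v p') \<bullet> (\<Phi> *v q') \<le> \<delta> * \<nu>\<^sup>2"
    by (simp add: algebra_simps)
  moreover have "(\<Phi> *v p') \<bullet> (\<Phi> *v q') = \<nu> * ((\<Phi> *v p) \<bullet> (\<Phi> *v q))"
    by (simp add: p'_def q'_def matrix_vector_mult_scaleR \<nu>_def)
  ultimately have "\<nu> * ((\<Phi> *v p) \<bullet> (\<Phi> *v q)) \<le> \<nu> * (\<delta> * \<nu>)"
    by (simp add: power2_eq_square mult.left_commute)
  then have "(\<Phi> *v p) \<bullet> (\<Phi> *v q) \<le> \<delta> * \<nu>" using \<nu> by simp
  then show ?thesis by (simp add: \<nu>_def mult.assoc)
qed auto

text \<open>Each squared correlation on \<open>S\<close> is at most every one on \<open>h\<close>,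
  so \<open>N\<close> times it is at most their sum over \<open>h\<close>. It remains to sum over
  the at most \<open>K\<close> indices of \<open>S\<close>.\<close>

lemma top_correlated_norm_le:
  fixes \<Phi> :: "real ^ 'n ^ 'm"
  assumes top: "top_correlated \<Phi> r N h" and disj: "h \<inter> S = {}" and S: "card S \<le> K"
  shows "sqrt N * norm (restrict_vec S (r v* \<Phi>)) \<le> sqrt K * norm (restrict_vec h (r v* \<Phi>))"
proof -
  define c where "c = r v* \<Phi>"
  have nsq: "(norm (restrict_vec I c))\<^sup>2 = (\<Sum>j\<in>I. (c $ j)\<^sup>2)" for I
    by (simp only: norm_restrict_vec_sq inner_restrict_vec) (simp add: power2_eq_square)
  have le: "(c $ j)\<^sup>2 \<le> (c $ i)\<^sup>2" if "j \<in> S" "i \<in> h" for i j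
    using that top disj unfolding top_correlated_def c_def vector_matrix_mult_nth
    by (metis IntI abs_le_square_iff empty_iff)
  have "N * (c $ j)\<^sup>2 \<le> (norm (restrict_vec h c))\<^sup>2" if "j \<in> S" for j
  proof -
    have "N * (c $ j)\<^sup>2 = (\<Sum>i\<in>h. (c $ j)\<^sup>2)" using top by (simp add: top_correlated_def)
    also have "\<dots> \<le> (norm (restrict_vec h c))\<^sup>2"
      unfolding nsq using le that by (intro sum_mono) auto
    finally show ?thesis .
  qed
  then have "(\<Sum>j\<in>S. N * (c $ j)\<^sup>2) \<le> card S * (norm (restrict_vec h c))\<^sup>2"
    by (intro sum_bounded_above) auto
  also have "\<dots> \<le> K * (norm (restrict_vec h c))\<^sup>2"
    using S by (intro mult_right_mono) auto
  finally have "N * (norm (restrict_vec S c))\<^sup>2 \<le> K * (norm (restrict_vec h c))\<^sup>2"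
    by (simp add: nsq sum_distrib_left)
  then have "sqrt (N * (norm (restrict_vec S c))\<^sup>2) \<le> sqrt (K * (norm (restrict_vec h c))\<^sup>2)"
    by (rule real_sqrt_le_mono)
  then show ?thesis by (simp add: real_sqrt_mult c_def)
qed

section \<open>The residual at a failing iteration\<close>

lemma gap_pos:
  fixes N K :: nat and \<delta> :: real
  assumes "N \<ge> 1" "\<delta> < sqrt N / (sqrt K + sqrt N)"
  shows "sqrt N - (sqrt K + sqrt N) * \<delta> > 0"
proof -
  have "sqrt K + sqrt N > 0" using assms(1) by (simp add: add_nonneg_pos)
  then show ?thesis using assms(2) by (simp add: pos_less_divide_eq mult.commute)
qed

text \<open>The bound comes from estimating \<open>r \<bullet> b\<close> from both sides, where
  \<open>b\<close> is the signal part of the residual. The order \<open>L\<close> only has to cover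
  the index sets of this one iteration, which later makes \<open>N * K + 1\<close>
  sufficient.\<close>

lemma failed_selection_residual_bound:
  fixes \<Phi> :: "real ^ 'n ^ 'm" and x u :: "real ^ 'n" and e r :: "real ^ 'm"
    and \<Lambda> h :: "'n set" and \<delta> \<delta>K \<delta>N :: real and K N L :: nat
  assumes r: "r = \<Phi> *v (x - u) + e" and u: "supp u \<subseteq> \<Lambda>"
    and orth: "\<And>j. j \<in> \<Lambda> \<Longrightarrow> r \<bullet> column j \<Phi> = 0"
    and top: "top_correlated \<Phi> r N h" and N: "N \<ge> 1" and e: "e \<noteq> 0"
    and disj: "h \<inter> (supp x - \<Lambda>) = {}" and ne: "supp x - \<Lambda> \<noteq> {}"
    and S: "card (supp x - \<Lambda>) \<le> K" and L: "card (supp x \<union> \<Lambda> \<union> h) \<le> L"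
    and rip: "rip_bound \<Phi> L \<delta>" "rip_bound \<Phi> K \<delta>K" "rip_bound \<Phi> N \<delta>N"
    and nonneg: "\<delta> \<ge> 0" "\<delta>K \<ge> 0" "\<delta>N \<ge> 0"
    and gap: "\<delta> < sqrt N / (sqrt K + sqrt N)"
  shows "norm r < (sqrt N * (1 + \<delta>K) + sqrt (K * (1 + \<delta>N) * (1 + \<delta>K)))
      / (sqrt N - (sqrt K + sqrt N) * \<delta>) * norm e + norm e"
proof -
  obtain a where a: "supp a \<subseteq> \<Lambda>" "\<And>j. j \<in> \<Lambda> \<Longrightarrow> (e - \<Phi> *v a) \<bullet> column j \<Phi> = 0"
    "norm (e - \<Phi> *v a) \<le> norm e"
    using column_span_decomp[where v = e and I = \<Lambda> and \<Phi> = \<Phi>] by blast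
  define S where "S = supp x - \<Lambda>"
  define e' where "e' = e - \<Phi> *v a"
  \<comment> \<open>The part of the noise in the span of the columns in \<open>\<Lambda>\<close>
    moves into the signal. Since \<open>u\<close> and \<open>a\<close> vanish off
    \<open>\<Lambda>\<close>, \<open>w\<close> still agrees with \<open>x\<close> on
    \<open>S\<close>.\<close>
  define w where "w = x - u + a"
  define xS where "xS = restrict_vec S x"
  define b where "b = \<Phi> *v w"
  define c where "c = r v* \<Phi>"
  define g where "g = restrict_vec h c"
  define G where "G = sqrt N - (sqrt K + sqrt N) * \<delta>"
  have rw: "r = b + e'"
    by (simp add: r b_def w_def e'_def algebra_simps matrix_vector_right_distrib
        matrix_vector_mult_diff_distrib)
  have sN: "sqrt N > 0" using N by simp
  have G: "G > 0"
    unfolding G_def by (rule gap_pos[OF N gap])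
  have "G \<le> sqrt N * (1 - \<delta>)" using nonneg by (simp add: G_def algebra_simps)
  then have \<delta>1: "1 - \<delta> > 0" using G sN by (metis less_le_trans zero_less_mult_pos)
  have ne': "norm e' \<le> norm e" using a by (simp add: e'_def)
  have out: "u $ i = 0" "a $ i = 0" if "i \<notin> \<Lambda>" for i
    using that u a(1) by (auto simp: supp_def)
  have supp_w: "supp w \<subseteq> supp x \<union> \<Lambda>"
    using out by (fastforce simp: w_def supp_def)
  have xS_w: "xS = restrict_vec S w"
    using out by (simp add: xS_def w_def restrict_vec_def vec_eq_iff S_def)
  have supp_xS: "supp xS \<subseteq> S" by (simp add: xS_def supp_restrict_vec)
  obtain j where "j \<in> S" using ne by (auto simp: S_def)
  then have "xS $ j \<noteq> 0" by (auto simp: xS_def restrict_vec_def S_def supp_def)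
  then have "xS \<noteq> 0" by auto
  then have nxS: "norm xS > 0" by simp
  have xSw: "norm xS \<le> norm w" unfolding xS_w by (rule norm_restrict_vec_le)
  have "(w - xS) $ i = 0" if "i \<notin> \<Lambda>" for i
    using out[OF that] that by (auto simp: xS_def w_def restrict_vec_def S_def supp_def)
  then have wxS: "supp (w - xS) \<subseteq> \<Lambda>"
    unfolding supp_def by blast
  \<comment> \<open>\<open>w\<close> and \<open>xS\<close> differ only on \<open>\<Lambda>\<close>,
    where \<open>r\<close> and \<open>e'\<close> are orthogonal to all columns, so \<open>xS\<close>
    can replace \<open>w\<close> in inner products with both.\<close>
  have z: "r \<bullet> (\<Phi> *v (w - xS)) = 0"
    by (rule orthogonal_range_of_columns[OF orth wxS])
  have z': "e' \<bullet> (\<Phi> *v (w - xS)) = 0"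
    unfolding e'_def by (rule orthogonal_range_of_columns[OF a(2) wxS])
  from z z' have proj: "r \<bullet> (\<Phi> *v xS) = r \<bullet> b" "e' \<bullet> (\<Phi> *v xS) = e' \<bullet> b"
    by (simp_all add: matrix_vector_mult_diff_distrib inner_diff_right b_def)
  then have bb: "b \<bullet> (\<Phi> *v xS) = b \<bullet> b"
    unfolding rw by (simp add: inner_add_left)
  have Lw: "card (supp x \<union> \<Lambda>) \<le> L"
    using L by (meson card_mono finite finite_subset le_trans sup_ge1)
  have b_lower: "(1 - \<delta>) * (norm w)\<^sup>2 \<le> (norm b)\<^sup>2"
    unfolding b_def by (rule rip_lower[OF rip(1) supp_w Lw])
  then have b0: "norm b > 0"
  proof -
    have "(1 - \<delta>) * (norm w)\<^sup>2 > 0" using nxS xSw \<delta>1 by (intro mult_pos_pos) auto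
    then have "(norm b)\<^sup>2 > 0" using b_lower by linarith
    then show ?thesis by simp
  qed
  have \<Phi>xS: "norm (\<Phi> *v xS) \<le> sqrt (1 + \<delta>K) * norm xS"
    using S by (intro rip_upper_norm[OF rip(2) supp_xS]) (simp add: S_def)
  have "sqrt (1 + \<delta>K) * norm xS \<le> sqrt (1 + \<delta>K) * norm w"
    using nonneg xSw by (intro mult_left_mono) auto
  then have \<Phi>xSw: "norm (\<Phi> *v xS) \<le> sqrt (1 + \<delta>K) * norm w"
    using \<Phi>xS by linarith
  \<comment> \<open>By \<open>bb\<close> and Cauchy-Schwarz, \<open>b\<close> is no longer than
    \<open>\<Phi> *v xS\<close>. As \<open>xS\<close> has at most \<open>K\<close> nonzero entries,
    the constant involves \<open>\<delta>K\<close> here.\<close>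
  have "norm b * norm b \<le> norm b * norm (\<Phi> *v xS)"
    using bb norm_cauchy_schwarz[of b "\<Phi> *v xS"]
    by (simp add: power2_norm_eq_inner[symmetric] power2_eq_square)
  then have "norm b \<le> norm (\<Phi> *v xS)" using b0 by simp
  then have b_upper: "norm b \<le> sqrt (1 + \<delta>K) * norm w"
    using \<Phi>xSw by linarith

  have g_le: "norm g \<le> \<delta> * norm w + sqrt (1 + \<delta>N) * norm e"
  proof (cases "g = 0")
    case False
    \<comment> \<open>Correlations vanish on \<open>\<Lambda>\<close>, so \<open>g\<close> lives on
      \<open>h - \<Lambda>\<close>, away from the support of \<open>w\<close>; the signal thus
      contributes only with the factor \<open>\<delta>\<close>.\<close>
    have "supp c \<inter> \<Lambda> = {}"
      using orth by (auto simp: supp_def c_def vector_matrix_mult_nth)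
    then have supp_g: "supp g \<subseteq> h - \<Lambda>"
      by (auto simp: g_def supp_restrict_vec)
    then have "supp w \<inter> supp g = {}" using supp_w disj by blast
    then have 1: "b \<bullet> (\<Phi> *v g) \<le> \<delta> * norm w * norm g"
      unfolding b_def
      by (intro rip_disjoint_supp_inner_le[OF rip(1) _ L]) (use supp_w supp_g in auto)
    have "norm (\<Phi> *v g) \<le> sqrt (1 + \<delta>N) * norm g"
      by (rule rip_upper_norm[OF rip(3), of g h])
        (use supp_g top in \<open>auto simp: top_correlated_def\<close>)
    then have "norm e' * norm (\<Phi> *v g) \<le> norm e * (sqrt (1 + \<delta>N) * norm g)"
      using ne' by (intro mult_mono) auto
    then have 2: "e' \<bullet> (\<Phi> *v g) \<le> norm e * (sqrt (1 + \<delta>N) * norm g)"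
      using norm_cauchy_schwarz[of e' "\<Phi> *v g"] by linarith
    have "norm g * norm g = g \<bullet> c"
      using norm_restrict_vec_sq[of h c] by (simp add: g_def power2_eq_square)
    also have "\<dots> = r \<bullet> (\<Phi> *v g)"
      unfolding c_def by (subst inner_commute) (rule dot_lmul_matrix)
    also have "\<dots> \<le> (\<delta> * norm w + sqrt (1 + \<delta>N) * norm e) * norm g"
      using 1 2 by (simp add: rw inner_add_left algebra_simps)
    finally show ?thesis using False by simp
  qed (use nonneg in simp)

  \<comment> \<open>Pairing with \<open>xS\<close> shows that only the correlations at the missed
    indices \<open>S\<close> contribute.\<close>
  have "r \<bullet> b = restrict_vec S c \<bullet> xS"
  proof -
    have "r \<bullet> b = c \<bullet> xS" unfolding proj(1)[symmetric] c_def by (rule dot_lmul_matrix[symmetric])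
    also have "\<dots> = restrict_vec S x \<bullet> restrict_vec S c"
      unfolding xS_def by (simp only: inner_restrict_vec_both inner_commute[of c])
    also have "\<dots> = restrict_vec S c \<bullet> xS"
      unfolding xS_def by (rule inner_commute)
    finally show ?thesis .
  qed
  also have "\<dots> \<le> norm (restrict_vec S c) * norm w"
    using norm_cauchy_schwarz[of "restrict_vec S c" xS]
      mult_left_mono[OF xSw, of "norm (restrict_vec S c)"] by simp
  finally have "sqrt N * (r \<bullet> b) \<le> (sqrt N * norm (restrict_vec S c)) * norm w"
    using sN by (simp add: mult.assoc)
  also have "\<dots> \<le> (sqrt K * norm g) * norm w"
    unfolding g_def c_def
    by (intro mult_right_mono top_correlated_norm_le[OF top]) (use disj S in \<open>auto simp: S_def\<close>)
  also have "\<dots> \<le> (sqrt K * (\<delta> * norm w + sqrt (1 + \<delta>N) * norm e)) * norm w"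
    using g_le by (intro mult_right_mono mult_left_mono) auto
  finally have key: "sqrt N * (r \<bullet> b)
      \<le> (sqrt K * (\<delta> * norm w + sqrt (1 + \<delta>N) * norm e)) * norm w" .
  have rb: "r \<bullet> b = (norm b)\<^sup>2 + e' \<bullet> b"
    by (simp add: rw inner_add_left power2_norm_eq_inner)
  \<comment> \<open>The coefficients of \<open>(norm w)\<^sup>2\<close> combine to
    \<open>sqrt N * (1 - \<delta>) - sqrt K * \<delta>\<close>, which is \<open>G\<close>.\<close>
  have "sqrt N * ((1 - \<delta>) * (norm w)\<^sup>2 + e' \<bullet> b) \<le> sqrt N * (r \<bullet> b)"
    using sN b_lower unfolding rb by simp
  also note key
  finally have key2: "G * (norm w)\<^sup>2 \<le> sqrt K * sqrt (1 + \<delta>N) * norm e * norm w - sqrt N * (e' \<bullet> b)"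
    by (simp add: G_def algebra_simps power2_eq_square)
  have w0: "norm w > 0" using nxS xSw by linarith
  define D where "D = sqrt N * (1 + \<delta>K) + sqrt (K * (1 + \<delta>N) * (1 + \<delta>K))"
  define P where "P = sqrt (1 + \<delta>K)"
  have P: "P > 0" using nonneg by (simp add: P_def add_pos_nonneg)
  \<comment> \<open>The outer \<open>P\<close> pays for passing from \<open>norm w\<close> to
    \<open>norm b\<close>. The bracket bounds \<open>G * norm w\<close>, with
    \<open>sqrt N * P\<close> reserved for a negative \<open>e' \<bullet> b\<close>.\<close>
  have D: "D = P * (sqrt N * P + sqrt K * sqrt (1 + \<delta>N))"
  proof -
    have "1 + \<delta>K = P * P" using nonneg by (simp add: P_def)
    moreover have "sqrt (K * (1 + \<delta>N) * (1 + \<delta>K)) = sqrt K * sqrt (1 + \<delta>N) * P"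
      by (simp only: P_def real_sqrt_mult)
    ultimately have "D = sqrt N * (P * P) + sqrt K * sqrt (1 + \<delta>N) * P"
      unfolding D_def by (simp only:)
    then show ?thesis by (simp only: distrib_left mult_ac)
  qed
  have bw: "G * norm b \<le> P * (G * norm w)"
    using mult_left_mono[OF b_upper, of G] G by (simp only: P_def mult.left_commute less_imp_le)
  text \<open>
    The sign of the inner product decides where strictness comes from: the lower bound on \<open>r \<bullet> b\<close>
    and the upper bound on \<open>norm r\<close> cannot both be sharp.
  \<close>
  have "G * norm r < D * norm e + G * norm e"
  proof (cases "e' \<bullet> b \<ge> 0")
    case True
    then have "sqrt N * (e' \<bullet> b) \<ge> 0" by simp
    then have "(G * norm w) * norm w \<le> (sqrt K * sqrt (1 + \<delta>N) * norm e) * norm w"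
      using key2 by (simp add: power2_eq_square mult.assoc)
    then have "G * norm w \<le> sqrt K * sqrt (1 + \<delta>N) * norm e"
      using w0 by simp
    then have "P * (G * norm w) \<le> P * (sqrt K * sqrt (1 + \<delta>N) * norm e)"
      using P by simp
    \<comment> \<open>In this case the summand \<open>sqrt N * P\<close> of the bracket is left over
      and gives strictness.\<close>
    moreover have "P * (sqrt N * P) * norm e > 0" using P sN e by simp
    moreover have "G * norm r \<le> G * norm b + G * norm e"
      unfolding rw distrib_left[symmetric]
      using G norm_triangle_ineq[of b e'] ne' by (intro mult_left_mono) auto
    ultimately show ?thesis using bw by (simp add: D algebra_simps)
  next
    case False
    have "\<bar>e' \<bullet> b\<bar> = \<bar>e' \<bullet> (\<Phi> *v xS)\<bar>" by (simp add: proj)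
    also have "\<dots> \<le> norm e' * norm (\<Phi> *v xS)" by (rule Cauchy_Schwarz_ineq2)
    also have "\<dots> \<le> norm e * (P * norm w)"
      unfolding P_def by (intro mult_mono ne' \<Phi>xSw) auto
    finally have "- (sqrt N * (e' \<bullet> b)) \<le> sqrt N * (norm e * (P * norm w))"
      using sN by (metis abs_le_D2 minus_mult_right mult_le_cancel_left_pos)
    then have "(G * norm w) * norm w \<le> ((sqrt N * P + sqrt K * sqrt (1 + \<delta>N)) * norm e) * norm w"
      using key2 by (simp add: algebra_simps power2_eq_square)
    then have "G * norm w \<le> (sqrt N * P + sqrt K * sqrt (1 + \<delta>N)) * norm e"
      using w0 by simp
    then have "P * (G * norm w) \<le> D * norm e"
      using P by (simp add: D mult.assoc)
    then have "G * norm b \<le> D * norm e" using bw by linarith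
    \<comment> \<open>The negative cross term in the expanded square makes the triangle inequality
      strict.\<close>
    moreover have "norm r < norm b + norm e"
    proof (rule power2_less_imp_less)
      have "(norm r)\<^sup>2 = (norm b)\<^sup>2 + 2 * (e' \<bullet> b) + (norm e')\<^sup>2"
        unfolding rw power2_norm_eq_inner by (simp add: inner_simps inner_commute)
      also have "\<dots> < (norm b)\<^sup>2 + (norm e)\<^sup>2"
        using False power_mono[OF ne' norm_ge_zero, of 2] by linarith
      also have "\<dots> \<le> (norm b + norm e)\<^sup>2"
        by (simp add: power2_sum)
      finally show "(norm r)\<^sup>2 < (norm b + norm e)\<^sup>2" .
    qed simp
    then have "G * norm r < G * norm b + G * norm e"
      using G by (metis distrib_left mult_less_cancel_left_pos)
    ultimately show ?thesis by linarith
  qed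
  then have "norm r < D / G * norm e + norm e"
    using G by (simp add: field_simps)
  then show ?thesis by (simp add: D_def G_def)
qed

section \<open>Growth of the support estimate along a run\<close>

lemma gomp_run_card_le:
  assumes "gomp_run \<Phi> v N K h \<Lambda> xh r" "k \<le> K"
  shows "card (\<Lambda> k) \<le> N * k"
  using assms(2)
proof (induction k)
  case 0
  then show ?case using assms(1) by (simp add: gomp_run_def)
next
  case (Suc k)
  have "Suc k \<in> {1..K}" using Suc.prems by simp
  then have "\<Lambda> (Suc k) = \<Lambda> k \<union> h (Suc k)" "card (h (Suc k)) = N"
    using assms(1) unfolding gomp_run_def top_correlated_def by (metis diff_Suc_1)+
  then show ?case using Suc card_Un_le[of "\<Lambda> k" "h (Suc k)"] by simp
qed

lemma gomp_run_mono:
  assumes "gomp_run \<Phi> v N K h \<Lambda> xh r" "k \<le> l" "l \<le> K"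
  shows "\<Lambda> k \<subseteq> \<Lambda> l"
  using assms(2,3)
proof (induction l rule: dec_induct)
  case (step l)
  then have "Suc l \<in> {1..K}" by simp
  then have "\<Lambda> (Suc l) = \<Lambda> l \<union> h (Suc l)"
    using assms(1) unfolding gomp_run_def by (metis diff_Suc_1)
  then show ?case using step by auto
qed simp

text \<open>Without a failure each iteration removes at least one missing index, so
  \<open>card (T - \<Lambda> k) \<le> K - k\<close> persists up to \<open>k = K\<close> and gives
  \<open>T \<subseteq> \<Lambda> K\<close>. The cardinality is recorded because it enters the order
  of the RIP.\<close>

lemma gomp_run_first_failure:
  assumes run: "gomp_run \<Phi> v N K h \<Lambda> xh r" and T: "card T \<le> K" "\<not> T \<subseteq> \<Lambda> K"
  obtains k where "k < K" "h (Suc k) \<inter> (T - \<Lambda> k) = {}" "card (T - \<Lambda> k) \<le> K - k"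
proof (rule ccontr)
  assume "\<not> thesis"
  with that have hit: "h (Suc k) \<inter> (T - \<Lambda> k) \<noteq> {}" if "k < K" "card (T - \<Lambda> k) \<le> K - k" for k
    using that by blast
  have "card (T - \<Lambda> k) \<le> K - k" if "k \<le> K" for k
    using that
  proof (induction k)
    case 0
    then show ?case using T(1) run by (simp add: gomp_run_def)
  next
    case (Suc k)
    then have IH: "card (T - \<Lambda> k) \<le> K - k" and k: "k < K" by simp_all
    then have "Suc k \<in> {1..K}" by simp
    then have "\<Lambda> (Suc k) = \<Lambda> k \<union> h (Suc k)"
      using run unfolding gomp_run_def by (metis diff_Suc_1)
    then have "T - \<Lambda> (Suc k) \<subset> T - \<Lambda> k" using hit[OF k IH] by blast
    then have "card (T - \<Lambda> (Suc k)) < card (T - \<Lambda> k)" by (intro psubset_card_mono) auto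
    then show ?case using IH by linarith
  qed
  from this[of K] T(2) show False by simp
qed

section \<open>From the final residual to the error of the estimate\<close>

theorem theorem4:
  fixes \<Phi> :: "real ^ 'n ^ 'm" and x :: "real ^ 'n" and e y' :: "real ^ 'm"
    and K N :: nat
    and h \<Lambda> :: "nat \<Rightarrow> 'n set" and xh :: "nat \<Rightarrow> real ^ 'n" and r :: "nat \<Rightarrow> real ^ 'm"
  assumes "K \<ge> 1" and "N \<ge> 1" and "N * K < CARD('m)"
    and "ksparse K x"
    and "y' = \<Phi> *v x + e" and "e \<noteq> 0"
    and "gomp_run \<Phi> y' N K h \<Lambda> xh r"
    and "\<And>k. k \<in> {1..K} \<Longrightarrow> full_column_rank_on \<Phi> (\<Lambda> k)"
    and "rip_const \<Phi> (N * K + K) < 1"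
    and "rip_const \<Phi> (N * K + 1) < sqrt (real N) / (sqrt (real K) + sqrt (real N))"
  shows "norm (x - xh K) < C_K2 \<Phi> N K * norm e"
proof -
  note run = assms(7)
  define \<delta> \<delta>K \<delta>N where "\<delta> = rip_const \<Phi> (N * K + 1)" and "\<delta>K = rip_const \<Phi> K"
    and "\<delta>N = rip_const \<Phi> N"
  define s where "s = sqrt (1 - rip_const \<Phi> (N * K + K))"
  define G where "G = sqrt N - (sqrt K + sqrt N) * \<delta>"
  define D where "D = sqrt N * (1 + \<delta>K) + sqrt (K * (1 + \<delta>N) * (1 + \<delta>K))"
  have rip: "rip_bound \<Phi> (N * K + 1) \<delta>" "rip_bound \<Phi> K \<delta>K" "rip_bound \<Phi> N \<delta>N"
    "rip_bound \<Phi> (N * K + K) (rip_const \<Phi> (N * K + K))"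
    using assms(1,2) unfolding \<delta>_def \<delta>K_def \<delta>N_def by (auto intro!: rip_const_attained(1))
  have nonneg: "\<delta> \<ge> 0" "\<delta>K \<ge> 0" "\<delta>N \<ge> 0"
    using rip_bound_nonneg rip(1-3) assms(1,2) by (metis le_add2)+
  have s: "s > 0" using assms(9) by (simp add: s_def)
  have G: "G > 0"
    unfolding G_def \<delta>_def by (rule gap_pos[OF assms(2,10)])
  have D: "D > 0"
    using assms(2) nonneg by (simp add: D_def add_pos_nonneg)
  \<comment> \<open>\<open>xh 0\<close> is arbitrary; the value 0 gives \<open>r 0\<close> the form
    of the later residuals, so a failure at the first iteration needs no separate argument.\<close>
  define u where "u k = (if k = 0 then 0 else xh k)" for k :: nat
  have supp_u: "supp (u k) \<subseteq> \<Lambda> k" and ru: "r k = y' - \<Phi> *v u k"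
    and orth: "\<And>j. j \<in> \<Lambda> k \<Longrightarrow> r k \<bullet> column j \<Phi> = 0" if "k \<le> K" for k
  proof -
    have "supp (u k) \<subseteq> \<Lambda> k \<and> r k = y' - \<Phi> *v u k \<and> (\<forall>j\<in>\<Lambda> k. r k \<bullet> column j \<Phi> = 0)"
    proof (cases "k = 0")
      case True
      then show ?thesis using run by (simp add: gomp_run_def u_def supp_def)
    next
      case False
      then have "k \<in> {1..K}" using that by simp
      then have "is_arg_min (\<lambda>z. norm (y' - \<Phi> *v z)) (\<lambda>z. supp z \<subseteq> \<Lambda> k) (xh k)"
        "r k = y' - \<Phi> *v xh k"
        using run unfolding gomp_run_def by blast+
      then show ?thesis
        using False least_squares_residual_orthogonal[of y' \<Phi> "\<Lambda> k" "xh k"]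
        by (auto simp: u_def is_arg_min_def)
    qed
    then show "supp (u k) \<subseteq> \<Lambda> k" "r k = y' - \<Phi> *v u k"
      "\<And>j. j \<in> \<Lambda> k \<Longrightarrow> r k \<bullet> column j \<Phi> = 0" by auto
  qed
  have uK: "u K = xh K" using assms(1) by (simp add: u_def)
  have "is_arg_min (\<lambda>z. norm (y' - \<Phi> *v z)) (\<lambda>z. supp z \<subseteq> \<Lambda> K) (xh K)"
    using run assms(1) unfolding gomp_run_def by (meson atLeastAtMost_iff order_refl)
  then have minK: "norm (r K) \<le> norm (y' - \<Phi> *v z)" if "supp z \<subseteq> \<Lambda> K" for z
    using that ru[of K] uK by (simp add: is_arg_min_linorder)
  have T: "card (supp x) \<le> K" using assms(4) by (simp add: ksparse_def)

  have rK: "norm (r K) < D / G * norm e + norm e"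
  proof (cases "supp x \<subseteq> \<Lambda> K")
    case True
    \<comment> \<open>Here \<open>x\<close> itself competes in the last least-squares problem, with
      residual \<open>e\<close>.\<close>
    then have "norm (r K) \<le> norm e" using minK[of x] by (simp add: assms(5))
    moreover have "D / G * norm e > 0" using D G assms(6) by simp
    ultimately show ?thesis by linarith
  next
    case False
    obtain k where k: "k < K" "h (Suc k) \<inter> (supp x - \<Lambda> k) = {}" "card (supp x - \<Lambda> k) \<le> K - k"
      using gomp_run_first_failure[OF run T False] .
    have "Suc k \<in> {1..K}" using k by simp
    then have top: "top_correlated \<Phi> (r k) N (h (Suc k))"
      using run unfolding gomp_run_def by (metis diff_Suc_1)
    have mono: "\<Lambda> k \<subseteq> \<Lambda> K" using gomp_run_mono[OF run, of k K] k by simp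
    have rk: "r k = \<Phi> *v (x - u k) + e"
      using ru[of k] k(1) by (simp add: assms(5) matrix_vector_mult_diff_distrib)
    have "supp x \<union> \<Lambda> k \<union> h (Suc k) = (supp x - \<Lambda> k) \<union> \<Lambda> k \<union> h (Suc k)" by blast
    then have "card (supp x \<union> \<Lambda> k \<union> h (Suc k))
        \<le> card (supp x - \<Lambda> k) + card (\<Lambda> k) + card (h (Suc k))"
      using card_Un_le[of "supp x - \<Lambda> k" "\<Lambda> k"] card_Un_le[of "(supp x - \<Lambda> k) \<union> \<Lambda> k" "h (Suc k)"]
      by simp
    also have "\<dots> \<le> (K - k) + N * k + N"
      using k gomp_run_card_le[OF run, of k] top by (intro add_mono) (auto simp: top_correlated_def)
    \<comment> \<open>With \<open>K = k + d + 1\<close> the right side exceeds the left by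
      \<open>(N - 1) * d\<close>.\<close>
    also have "\<dots> \<le> N * K + 1"
    proof -
      obtain d where "K = k + d + 1" using less_imp_Suc_add[OF k(1)] by auto
      moreover obtain M where "N = M + 1" using le_Suc_ex[OF assms(2)] by auto
      ultimately show ?thesis by (simp add: algebra_simps)
    qed
    finally have "norm (r k) < D / G * norm e + norm e"
      unfolding D_def G_def
      using failed_selection_residual_bound[OF rk supp_u orth top assms(2,6) k(2) _ _ _ rip(1-3) nonneg]
        k False mono assms(10) unfolding \<delta>_def by auto
    \<comment> \<open>Since \<open>\<Lambda> k \<subseteq> \<Lambda> K\<close>, the earlier estimate
      \<open>u k\<close> competes in the last least-squares problem.\<close>
    moreover have "norm (r K) \<le> norm (r k)"
      using minK[of "u k"] supp_u[of k] ru[of k] k mono by auto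
    ultimately show ?thesis by linarith
  qed

  have card_K: "card (supp x \<union> \<Lambda> K) \<le> N * K + K"
    using card_Un_le[of "supp x" "\<Lambda> K"] gomp_run_card_le[OF run, of K] T by simp
  have supp_K: "supp (x - xh K) \<subseteq> supp x \<union> \<Lambda> K"
    using supp_u[of K] uK by (auto simp: supp_def)
  have "(1 - rip_const \<Phi> (N * K + K)) * (norm (x - xh K))\<^sup>2 \<le> (norm (\<Phi> *v (x - xh K)))\<^sup>2"
    by (rule rip_lower[OF rip(4) supp_K card_K])
  moreover have "s\<^sup>2 = 1 - rip_const \<Phi> (N * K + K)"
    using assms(9) by (simp add: s_def)
  ultimately have "(s * norm (x - xh K))\<^sup>2 \<le> (norm (\<Phi> *v (x - xh K)))\<^sup>2"
    by (simp only: power_mult_distrib)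
  then have "s * norm (x - xh K) \<le> norm (\<Phi> *v (x - xh K))"
    by (rule power2_le_imp_le) (rule norm_ge_zero)
  also have "\<Phi> *v (x - xh K) = r K - e"
    using ru[of K] uK by (simp add: assms(5) matrix_vector_mult_diff_distrib)
  \<comment> \<open>One \<open>norm e\<close> belongs to the residual bound and one comes from
    splitting off the noise, whence the 2.\<close>
  also have "norm (r K - e) < (D / G + 2) * norm e"
    using norm_triangle_ineq4[of "r K" e] rK by (simp add: distrib_right)
  finally have "norm (x - xh K) < (D / G + 2) * norm e / s"
    using s by (simp add: field_simps)
  also have "\<dots> = (D / (G * s) + 2 / s) * norm e"
    using s G by (simp add: field_simps)
  also have "D / (G * s) + 2 / s = C_K2 \<Phi> N K"
    by (simp add: C_K2_def D_def G_def s_def \<delta>_def \<delta>K_def \<delta>N_def)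
  finally show ?thesis .
qed

end
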